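(* Let $H$ be a graph of order $n$ and let $r\ge 1$. If $H$ is partitionable into two global offensive alliances, then $$\gamma_o(K_{r}\Box H)\le \left\lfloor\frac{rn}{2}\right\rfloor.$$
   Context: All graphs are finite and simple; $K_r$ is the complete graph on $r$ vertices. For a graph with vertex set $V$, a vertex $v$ and $S\subseteq V$, let $\delta_S(v)=|N(v)\cap S|$ and $\overline{S}=V\setminus S$. A nonempty set $S\subseteq V$ is a global offensive alliance if $\delta_S(v)\ge \delta_{\overline{S}}(v)+1$ for every $v\in\overline{S}$; $\gamma_o(G)$ is the minimum cardinality of a global offensive alliance of $G$. $H$ is partitionable into two global offensive alliances if there is a partition $\{Y_1,Y_2\}$ of $V(H)$ with both $Y_1$ and $Y_2$ global offensive alliances of $H$. $G\Box H$ is the Cartesian product: vertex set $V(G)\times V(H)$, with $(a,b)\sim(c,d)$ iff ($a=c$ and $b\sim d$ in $H$) or ($a\sim c$ in $G$ and $b=d$). *)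

theory Defs
  imports "Graph_Theory.Graph_Theory"
begin

text \<open>
  A finite simple graph is a \<^locale>\<open>pair_graph\<close>: an undirected edge between \<open>u\<close> and \<open>v\<close>
  is present as both arcs \<open>(u, v)\<close> and \<open>(v, u)\<close>, so the open neighbourhood of \<open>v\<close> is the
  image of \<open>{v}\<close> under the arc relation.
\<close>

definition nbhd :: "'a pair_pre_digraph \<Rightarrow> 'a \<Rightarrow> 'a set" where
  "nbhd G v = parcs G `` {v}"

definition deg_in :: "'a pair_pre_digraph \<Rightarrow> 'a set \<Rightarrow> 'a \<Rightarrow> nat" where
  "deg_in G S v = card (nbhd G v \<inter> S)"

definition global_offensive_alliance :: "'a pair_pre_digraph \<Rightarrow> 'a set \<Rightarrow> bool" where
  "global_offensive_alliance G S \<longleftrightarrow>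
     S \<noteq> {} \<and> S \<subseteq> pverts G \<and>
     (\<forall>v \<in> pverts G - S. deg_in G S v \<ge> deg_in G (pverts G - S) v + 1)"

text \<open>
  The minimum is over a nonempty set as soon as \<open>G\<close> has a vertex; see
  \<open>global_offensive_alliance_pverts\<close> below.
\<close>

definition offensive_alliance_number :: "'a pair_pre_digraph \<Rightarrow> nat" (\<open>\<gamma>\<^sub>o\<close>) where
  "\<gamma>\<^sub>o G = (LEAST k. \<exists>S. global_offensive_alliance G S \<and> card S = k)"

definition partitionable_into_two_goa :: "'a pair_pre_digraph \<Rightarrow> bool" where
  "partitionable_into_two_goa H \<longleftrightarrow>
     (\<exists>Y1 Y2. Y1 \<union> Y2 = pverts H \<and> Y1 \<inter> Y2 = {} \<and>
        global_offensive_alliance H Y1 \<and> global_offensive_alliance H Y2)"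

definition cartesian_product ::
  "'a pair_pre_digraph \<Rightarrow> 'b pair_pre_digraph \<Rightarrow> ('a \<times> 'b) pair_pre_digraph"
  (infixl \<open>\<box>\<close> 70) where
  "G \<box> H = \<lparr> pverts = pverts G \<times> pverts H,
     parcs = {((a, b), (c, d)) | a b c d.
       (a, b) \<in> pverts G \<times> pverts H \<and> (c, d) \<in> pverts G \<times> pverts H \<and>
       (a = c \<and> (b, d) \<in> parcs H \<or> (a, c) \<in> parcs G \<and> b = d)} \<rparr>"

lemma global_offensive_alliance_pverts:
  "pverts G \<noteq> {} \<Longrightarrow> global_offensive_alliance G (pverts G)"
  by (simp add: global_offensive_alliance_def)

lemma pair_graph_cartesian_product:
  assumes "pair_graph G" "pair_graph H"
  shows "pair_graph (G \<box> H)"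
proof -
  interpret G: pair_graph G by fact
  interpret H: pair_graph H by fact
  have sub: "parcs (G \<box> H) \<subseteq> (pverts G \<times> pverts H) \<times> (pverts G \<times> pverts H)"
    by (auto simp: cartesian_product_def)
  have fin: "finite (pverts G \<times> pverts H)"
    by simp
  have symG: "(a, c) \<in> parcs G \<Longrightarrow> (c, a) \<in> parcs G" for a c
    using G.sym_arcs by (auto simp: symmetric_def dest: symD)
  have symH: "(a, c) \<in> parcs H \<Longrightarrow> (c, a) \<in> parcs H" for a c
    using H.sym_arcs by (auto simp: symmetric_def dest: symD)
  show ?thesis
  proof unfold_locales
    show "finite (parcs (G \<box> H))"
      using finite_subset[OF sub] fin by blast
    show "symmetric (with_proj (G \<box> H))"
      by (auto simp: symmetric_def cartesian_product_def intro!: symI dest: symG symH)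
  qed (use G.pair_no_loops H.pair_no_loops in \<open>fastforce simp: cartesian_product_def\<close>)+
qed

end

theory Submission
  imports Defs
begin

text \<open>
  Split \<open>V(K\<^sub>r)\<close> into halves \<open>A\<close>, \<open>B\<close> whose sizes differ by at most one, so that every vertex
  has at least as many neighbours in the other half as in its own. If \<open>{Y\<^sub>1, Y\<^sub>2}\<close> partitions
  \<open>V(H)\<close> into global offensive alliances, then \<open>A \<times> Y\<^sub>1 \<union> B \<times> Y\<^sub>2\<close> and
  \<open>A \<times> Y\<^sub>2 \<union> B \<times> Y\<^sub>1\<close> are complementary global offensive alliances of the product: the
  \<open>H\<close>-neighbours supply the strict majority and the \<open>K\<^sub>r\<close>-neighbours do not spoil it. The
  smaller one has at most \<open>r n / 2\<close> vertices.
\<close>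

lemma pverts_cartesian_product [simp]: "pverts (G \<box> H) = pverts G \<times> pverts H"
  by (simp add: cartesian_product_def)

lemma finite_nbhd:
  assumes "pair_fin_digraph G"
  shows "finite (nbhd G v)"
proof -
  interpret pair_fin_digraph G by fact
  show ?thesis by (simp add: nbhd_def finite_Image)
qed

lemma nbhd_subset_pverts:
  assumes "pair_wf_digraph G"
  shows "nbhd G v \<subseteq> pverts G"
proof -
  interpret pair_wf_digraph G by fact
  show ?thesis by (auto simp: nbhd_def dest: in_arcsD2)
qed

lemma nbhd_cartesian_product:
  assumes "pair_wf_digraph G" "pair_wf_digraph H" "a \<in> pverts G" "b \<in> pverts H"
  shows "nbhd (G \<box> H) (a, b) = {a} \<times> nbhd H b \<union> nbhd G a \<times> {b}"
  using assms nbhd_subset_pverts[of G a] nbhd_subset_pverts[of H b]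
  by (auto simp: nbhd_def cartesian_product_def)

text \<open>The neighbours of \<open>(a, b)\<close> lie on the two fibres through it, which meet
  only in \<open>(a, b)\<close> itself. Degrees into \<open>S\<close> therefore add, each measured
  against the slice of \<open>S\<close> on its fibre.\<close>

lemma deg_in_cartesian_product:
  assumes "pair_graph G" "pair_graph H" "a \<in> pverts G" "b \<in> pverts H"
  shows "deg_in (G \<box> H) S (a, b) = deg_in H {y. (a, y) \<in> S} b + deg_in G {x. (x, b) \<in> S} a"
proof -
  interpret G: pair_graph G by fact
  interpret H: pair_graph H by fact
  have fin: "finite (nbhd G a)" "finite (nbhd H b)"
    by (intro finite_nbhd G.pair_fin_digraph_axioms H.pair_fin_digraph_axioms)+
  \<comment> \<open>Looplessness makes the two pieces below disjoint: the first coordinate is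
    \<open>a\<close> in one and never \<open>a\<close> in the other.\<close>
  have "a \<notin> nbhd G a"
    using G.pair_no_loops[of "(a, a)"] by (auto simp: nbhd_def)
  moreover have "nbhd (G \<box> H) (a, b) = {a} \<times> nbhd H b \<union> nbhd G a \<times> {b}"
    by (intro nbhd_cartesian_product assms G.pair_wf_digraph_axioms H.pair_wf_digraph_axioms)
  ultimately have "nbhd (G \<box> H) (a, b) \<inter> S =
      {a} \<times> (nbhd H b \<inter> {y. (a, y) \<in> S}) \<union> (nbhd G a \<inter> {x. (x, b) \<in> S}) \<times> {b}"
    and "({a} \<times> (nbhd H b \<inter> {y. (a, y) \<in> S})) \<inter> ((nbhd G a \<inter> {x. (x, b) \<in> S}) \<times> {b}) = {}"
    by auto
  then show ?thesis
    using fin by (simp add: deg_in_def card_Un_disjoint card_cartesian_product)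
qed

text \<open>On the fibres through a vertex outside the set, the set and its complement cut out the
  two parts of each factor. A strict inequality in \<open>H\<close> plus a weak one in
  \<open>G\<close> is strict.\<close>

lemma global_offensive_alliance_cartesian_product:
  assumes "pair_graph G" "pair_graph H" "pverts G \<noteq> {}"
    and G: "A \<union> B = pverts G" "A \<inter> B = {}"
      "\<And>v. v \<in> A \<Longrightarrow> deg_in G A v \<le> deg_in G B v"
      "\<And>v. v \<in> B \<Longrightarrow> deg_in G B v \<le> deg_in G A v"
    and H: "Y1 \<union> Y2 = pverts H" "Y1 \<inter> Y2 = {}"
      "global_offensive_alliance H Y1" "global_offensive_alliance H Y2"
  shows "global_offensive_alliance (G \<box> H) (A \<times> Y1 \<union> B \<times> Y2)"
proof -
  let ?S = "A \<times> Y1 \<union> B \<times> Y2"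
  let ?V = "pverts G \<times> pverts H"
  have diff: "pverts H - Y1 = Y2" "pverts H - Y2 = Y1"
    using H(1,2) by auto
  \<comment> \<open>Each part, being an alliance, dominates the vertices of the other part.\<close>
  have maj: "y \<in> Y2 \<Longrightarrow> deg_in H Y2 y < deg_in H Y1 y"
    "y \<in> Y1 \<Longrightarrow> deg_in H Y1 y < deg_in H Y2 y" for y
    using H(3,4) by (auto simp: global_offensive_alliance_def diff)
  have "deg_in (G \<box> H) (?V - ?S) (a, y) < deg_in (G \<box> H) ?S (a, y)"
    if v: "(a, y) \<in> ?V - ?S" for a y
  proof -
    have in_V: "a \<in> pverts G" "y \<in> pverts H"
      using that by auto
    note deg = deg_in_cartesian_product[OF assms(1,2) in_V]
    consider "a \<in> A" "y \<in> Y2" | "a \<in> B" "y \<in> Y1"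
      using v by (auto simp flip: G(1) H(1))
    then show ?thesis
    proof cases
      case 1
      then have "{y'. (a, y') \<in> ?S} = Y1" "{x. (x, y) \<in> ?S} = B"
        "{y'. (a, y') \<in> ?V - ?S} = Y2" "{x. (x, y) \<in> ?V - ?S} = A"
        using G(2) H(2) by (auto simp flip: G(1) H(1))
      then show ?thesis
        using maj(1)[OF 1(2)] G(3)[OF 1(1)] by (simp only: deg add_less_le_mono)
    next
      case 2
      then have "{y'. (a, y') \<in> ?S} = Y2" "{x. (x, y) \<in> ?S} = A"
        "{y'. (a, y') \<in> ?V - ?S} = Y1" "{x. (x, y) \<in> ?V - ?S} = B"
        using G(2) H(2) by (auto simp flip: G(1) H(1))
      then show ?thesis
        using maj(2)[OF 2(2)] G(4)[OF 2(1)] by (simp only: deg add_less_le_mono)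
    qed
  qed
  then have "\<forall>v \<in> ?V - ?S. deg_in (G \<box> H) ?S v \<ge> deg_in (G \<box> H) (?V - ?S) v + 1"
    by (auto simp: Suc_le_eq)
  \<comment> \<open>One of \<open>A\<close> and \<open>B\<close> may be empty, so a point of
    \<open>A \<union> B\<close> is paired with a point of \<open>Y1\<close> or \<open>Y2\<close>,
    both nonempty as alliances.\<close>
  moreover have "?S \<noteq> {}"
    using assms(3) G(1) H(3,4) by (auto simp: global_offensive_alliance_def)
  moreover have "?S \<subseteq> ?V"
    by (auto simp flip: G(1) H(1))
  ultimately show ?thesis
    by (simp add: global_offensive_alliance_def)
qed

lemma offensive_alliance_number_le:
  "global_offensive_alliance G S \<Longrightarrow> \<gamma>\<^sub>o G \<le> card S"
  unfolding offensive_alliance_number_def by (intro Least_le) blast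

text \<open>The smaller of two complementary alliances has at most half of the vertices, and
  integrality of its size gives the floor.\<close>

lemma offensive_alliance_number_le_half:
  assumes "finite (pverts G)" "S \<union> T = pverts G" "S \<inter> T = {}"
    and "global_offensive_alliance G S" "global_offensive_alliance G T"
  shows "\<gamma>\<^sub>o G \<le> card (pverts G) div 2"
proof -
  have "card S + card T = card (pverts G)"
    using assms(1-3) by (metis card_Un_disjoint finite_Un)
  then show ?thesis
    using offensive_alliance_number_le[OF assms(4)] offensive_alliance_number_le[OF assms(5)]
    by linarith
qed

lemma complete_digraph_nbhd:
  assumes "complete_digraph r (with_proj K)" "v \<in> pverts K"
  shows "nbhd K v = pverts K - {v}"
  using assms by (auto simp: nbhd_def complete_digraph_pair_def)

text \<open>A vertex misses only itself among the vertices of its own half, so that half may exceed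
  the other by one.\<close>

lemma complete_digraph_balanced_partition:
  assumes K: "complete_digraph r (with_proj K)"
  obtains A B where "A \<union> B = pverts K" "A \<inter> B = {}"
    "\<And>v. v \<in> A \<Longrightarrow> deg_in K A v \<le> deg_in K B v"
    "\<And>v. v \<in> B \<Longrightarrow> deg_in K B v \<le> deg_in K A v"
proof -
  interpret pair_graph K
    by (rule pair_graphI_complete[OF K])
  have card: "card (pverts K) = r"
    using K by (simp add: complete_digraph_def)
  then obtain A where A: "A \<subseteq> pverts K" "card A = r div 2"
    by (metis obtain_subset_with_card_n div_le_dividend)
  let ?B = "pverts K - A"
  have B: "card ?B = r - r div 2"
    using A card by (simp add: card_Diff_subset finite_subset)
  have deg: "deg_in K X v = card X - 1" "deg_in K Y v = card Y"
    if "v \<in> X" "X \<subseteq> pverts K" "Y \<subseteq> pverts K" "X \<inter> Y = {}" for X Y v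
  proof -
    have "nbhd K v = pverts K - {v}"
      using that by (intro complete_digraph_nbhd[OF K]) auto
    then have "nbhd K v \<inter> X = X - {v}" "nbhd K v \<inter> Y = Y"
      using that by auto
    then show "deg_in K X v = card X - 1" "deg_in K Y v = card Y"
      using that by (simp_all add: deg_in_def)
  qed
  show thesis
  proof (rule that[of A ?B])
    show "deg_in K A v \<le> deg_in K ?B v" if "v \<in> A" for v
      using deg[of v A ?B] that A B by simp linarith
    \<comment> \<open>For odd \<open>r\<close> the half \<open>?B\<close> is the larger one, and the
      bound is an equality: \<open>r - r div 2 - 1 = r div 2\<close>.\<close>
    show "deg_in K ?B v \<le> deg_in K A v" if "v \<in> ?B" for v
      using deg[of v ?B A] that A B by (auto simp: Int_commute)
  qed (use A in auto)
qed

theorem theorem11: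
  fixes K :: "'a pair_pre_digraph" and H :: "'b pair_pre_digraph" and r n :: nat
  assumes "pair_graph H" and "card (pverts H) = n"
    and "r \<ge> 1" and "complete_digraph r (with_proj K)"
    and "partitionable_into_two_goa H"
  shows "\<gamma>\<^sub>o (K \<box> H) \<le> r * n div 2"
proof -
  interpret H: pair_graph H by fact
  note pgK = pair_graphI_complete[OF assms(4)]
  then interpret K: pair_graph K .
  have card: "card (pverts K) = r"
    using assms(4) by (simp add: complete_digraph_def)
  then have ne: "pverts K \<noteq> {}"
    using assms(3) by auto
  obtain A B where AB: "A \<union> B = pverts K" "A \<inter> B = {}"
    "\<And>v. v \<in> A \<Longrightarrow> deg_in K A v \<le> deg_in K B v"
    "\<And>v. v \<in> B \<Longrightarrow> deg_in K B v \<le> deg_in K A v"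
    using complete_digraph_balanced_partition[OF assms(4)] by metis
  obtain Y1 Y2 where Y: "Y1 \<union> Y2 = pverts H" "Y1 \<inter> Y2 = {}"
    "global_offensive_alliance H Y1" "global_offensive_alliance H Y2"
    using assms(5) by (auto simp: partitionable_into_two_goa_def)
  have Y': "Y2 \<union> Y1 = pverts H" "Y2 \<inter> Y1 = {}"
    using Y(1,2) by auto
  have "\<gamma>\<^sub>o (K \<box> H) \<le> card (pverts (K \<box> H)) div 2"
  proof (rule offensive_alliance_number_le_half)
    show "global_offensive_alliance (K \<box> H) (A \<times> Y1 \<union> B \<times> Y2)"
      by (rule global_offensive_alliance_cartesian_product[OF pgK assms(1) ne AB Y])
    \<comment> \<open>Exchanging \<open>Y1\<close> and \<open>Y2\<close> turns the first set into
      its complement, and the hypotheses on them are symmetric.\<close>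
    show "global_offensive_alliance (K \<box> H) (A \<times> Y2 \<union> B \<times> Y1)"
      by (rule global_offensive_alliance_cartesian_product[OF pgK assms(1) ne AB Y' Y(4,3)])
    show "(A \<times> Y1 \<union> B \<times> Y2) \<union> (A \<times> Y2 \<union> B \<times> Y1) = pverts (K \<box> H)"
      using AB(1) Y(1) by auto
    show "(A \<times> Y1 \<union> B \<times> Y2) \<inter> (A \<times> Y2 \<union> B \<times> Y1) = {}"
      using AB(2) Y(2) by auto
  qed simp
  then show ?thesis
    by (simp add: card_cartesian_product card assms(2))
qed

end
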